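(* Let $G$ be a graph without isolated vertices. The 3-arc graph $X(G)$ of $G$ is hamiltonian if and only if all of the following hold: (a) $\delta(G) \ge 2$; (b) no two degree-two vertices of $G$ are adjacent; and (c) the subgraph obtained from $G$ by deleting all degree-two vertices is connected.
   Context: All graphs are finite, undirected, without loops and without parallel edges. $\delta(G)$ denotes the minimum degree of $G$. An arc of a graph $G$ is an ordered pair $uv$ of adjacent vertices $u,v$ (so $uv \neq vu$, and each edge gives two arcs); $A(G)$ is the set of all arcs of $G$. A 3-arc of $G$ is a 4-tuple $(v,u,x,y)$ of vertices, possibly with $v=y$, such that both $(v,u,x)$ and $(u,x,y)$ are paths of $G$ (i.e. $v\ne x$, $u\neq y$, and $\{v,u\},\{u,x\},\{x,y\}$ are edges of $G$). The 3-arc graph $X(G)$ of $G$ is the graph with vertex set $A(G)$ in which the vertices corresponding to arcs $uv$ and $xy$ are adjacent if and only if $(v,u,x,y)$ is a 3-arc of $G$. A graph is hamiltonian if it contains a Hamilton cycle, i.e. a cycle containing every vertex. *)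

theory Defs
  imports "Graph_Theory.Graph_Theory"
begin

text \<open>
  Finite simple graphs are modelled by \<^locale>\<open>pair_graph\<close>: a finite vertex set with a finite,
  symmetric, irreflexive set of ordered pairs. So \<^term>\<open>parcs G\<close> is literally the arc set
  \<open>A(G)\<close>, each edge contributing its two orientations.
\<close>

text \<open>
  In a symmetric digraph the arcs leaving \<open>v\<close> correspond to the edges at \<open>v\<close>, so the degree of a
  vertex is its out-degree.
\<close>
abbreviation degree :: "'a pair_pre_digraph \<Rightarrow> 'a \<Rightarrow> nat" where
  "degree G v \<equiv> out_degree (with_proj G) v"

text \<open>Unspecified for the graph without vertices.\<close>
definition min_degree :: "'a pair_pre_digraph \<Rightarrow> nat" where
  "min_degree G = Min (degree G ` pverts G)"

definition three_arc :: "'a pair_pre_digraph \<Rightarrow> 'a \<Rightarrow> 'a \<Rightarrow> 'a \<Rightarrow> 'a \<Rightarrow> bool" where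
  "three_arc G v u x y \<longleftrightarrow>
     (v, u) \<in> parcs G \<and> (u, x) \<in> parcs G \<and> (x, y) \<in> parcs G \<and> v \<noteq> x \<and> u \<noteq> y"

text \<open>The first arc is read backwards: \<open>uv\<close> is adjacent to \<open>xy\<close> when \<open>(v, u, x, y)\<close> is a 3-arc.\<close>
definition three_arc_graph :: "'a pair_pre_digraph \<Rightarrow> ('a \<times> 'a) pair_pre_digraph" where
  "three_arc_graph G =
     \<lparr> pverts = parcs G,
       parcs = {((u, v), (x, y)) | u v x y.
                  (u, v) \<in> parcs G \<and> (x, y) \<in> parcs G \<and> three_arc G v u x y} \<rparr>"

text \<open>
  \<^const>\<open>pre_digraph.cycle\<close> admits the closed walk \<open>a, b, a\<close>, which is not a cycle of an
  undirected graph; a closed walk with at least three arcs and no repeated vertex is one.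
\<close>
definition (in pre_digraph) hamilton_cycle :: "'a \<Rightarrow> 'b awalk \<Rightarrow> bool" where
  "hamilton_cycle u p \<longleftrightarrow>
     awalk u p u \<and> cycle p \<and> 3 \<le> length p \<and> set (awalk_verts u p) = verts G"

definition hamiltonian :: "('a, 'b) pre_digraph \<Rightarrow> bool" where
  "hamiltonian G \<longleftrightarrow> (\<exists>u p. pre_digraph.hamilton_cycle G u p)"

lemma pair_graph_three_arc_graph:
  assumes "pair_graph G"
  shows "pair_graph (three_arc_graph G)"
proof -
  interpret pair_graph G by (fact assms)
  have sub: "parcs (three_arc_graph G) \<subseteq> parcs G \<times> parcs G"
    by (auto simp: three_arc_graph_def)
  have fin: "finite (parcs (three_arc_graph G))"
    using finite_subset[OF sub] pair_finite_arcs by blast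
  have flip: "three_arc G v u x y \<Longrightarrow> three_arc G y x u v" for v u x y
    using arcs_symmetric unfolding three_arc_def by blast
  have noloop: "\<not> three_arc G v u u y" for v u y
    using no_loops' unfolding three_arc_def by blast
  show ?thesis
  proof
    show "symmetric (with_proj (three_arc_graph G))"
      by (auto simp: symmetric_def sym_def three_arc_graph_def intro: flip)
  qed (use sub fin pair_finite_arcs noloop in \<open>auto simp: three_arc_graph_def\<close>)
qed

end

theory Submission
  imports Defs
begin

text \<open>
  A Hamilton cycle of \<open>X(G)\<close> is a cyclic list of all arcs of \<open>G\<close> whose tails form a closed walk in
  \<open>G\<close>. The walk visits each vertex \<open>u\<close> once for every neighbour \<open>v\<close>, the visit being labelled by the
  arc \<open>uv\<close>, and adjacency in \<open>X(G)\<close> says that the label \<open>v\<close> of a visit is neither the vertex visited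
  just before nor the one visited just after. Call this unordered pair of walk neighbours
  the context of the arc, and call the arc in conflict if its head occurs in its context.

  Necessity. A visit labelled \<open>v\<close> needs a neighbour of \<open>u\<close> other than \<open>v\<close>, so degrees are at least
  two. If \<open>u\<close> has exactly the neighbours \<open>x\<close> and \<open>v\<close>, then the visit labelled \<open>v\<close> goes \<open>x, u, x\<close>.
  Hence two adjacent vertices of degree two would force the predecessor and the successor of an arc
  to coincide, and cutting the excursions \<open>x, u, x\<close> out of the walk leaves a walk through all other
  vertices, which are therefore connected without the vertices of degree two
  (\<open>three_arc_graph_hamiltonian_necessary\<close>).

  Sufficiency. Consider cyclic lists of all arcs, conflicts permitted, in which the walk traverses
  every edge exactly twice and passes vertices of degree two only as \<open>x, u, x\<close>. Such a tour
  exists: start with one edge walked back and forth, and keep inserting excursions \<open>a, b, a\<close> at visited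
  vertices \<open>a\<close> of degree other than two. Connectivity guarantees that this reaches all arcs
  (\<open>exists_full_tour\<close>). Among all such tours take one with the fewest conflicts, and suppose that
  \<open>ux\<close> is in conflict, with context \<open>{x, p}\<close>. Exchanging the labels of two visits to \<open>u\<close> is harmless to
  the tour. Since every neighbour of \<open>u\<close> occurs only twice in the contexts at \<open>u\<close>, at most two other
  visits fail to give an improvement, so an improving exchange exists unless \<open>u\<close> has exactly three
  neighbours \<open>x, p, k\<close> and its contexts are \<open>{x, p}\<close>, \<open>{x, p}\<close>, \<open>{k, k}\<close>. This
  case admits no conflict-free labelling whatever, but reversing the stretch of
  the walk between a visit with context \<open>{x, p}\<close> and the one with \<open>{k, k}\<close> turns these two contexts
  into \<open>{x, k}\<close> and \<open>{p, k}\<close>, which the labels \<open>p\<close> and \<open>x\<close> fit. Either way the number of conflicts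
  drops (\<open>tour_improve\<close>), so a best tour has none and is a Hamilton cycle.

  Reversal is the reason for treating walks as undirected and contexts as unordered pairs. A tour
  grown from excursions traverses each edge once in each direction, and in the complete graph on
  four vertices no tour of that kind is free of conflicts: it would be a cyclic permutation of the
  twelve arcs, hence odd, yet composed of the even permutation reversing all arcs and of even
  permutations of the neighbours at each vertex.
\<close>

section \<open>Hamilton cycles, degrees and connectivity in elementary terms\<close>

lemma pcas_iff_nth:
  assumes "p \<noteq> []"
  shows "pcas u p v \<longleftrightarrow> fst (p ! 0) = u \<and> snd (p ! (length p - 1)) = v \<and>
           (\<forall>i. Suc i < length p \<longrightarrow> snd (p ! i) = fst (p ! Suc i))"
  using assms
proof (induction p arbitrary: u)
  case Nil
  then show ?case by simp
next
  case (Cons e es)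
  show ?case
  proof (cases "es = []")
    case False
    have shift: "(\<forall>i. i < length es \<longrightarrow> P i) \<longleftrightarrow> P 0 \<and> (\<forall>i. Suc i < length es \<longrightarrow> P (Suc i))" for P
      using False by (metis length_greater_0_conv not0_implies_Suc)
    have "snd ((e # es) ! length es) = snd (es ! (length es - 1))"
      using False by (simp add: nth_Cons')
    then show ?thesis
      using Cons.IH[OF False, of "snd e"] shift[of "\<lambda>i. snd ((e # es) ! i) = fst (es ! i)"]
      by auto
  qed simp
qed

text \<open>
  Listing the vertices instead of the arcs of the cycle is what makes rotating, cutting and reversing
  a Hamilton cycle a matter of list operations.
\<close>
lemma hamiltonian_iff_cyclic_list:
  "hamiltonian (with_proj H) \<longleftrightarrow>
     (\<exists>L. 3 \<le> length L \<and> distinct L \<and> set L = pverts H \<and>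
          (\<forall>i<length L. (L ! i, L ! (Suc i mod length L)) \<in> parcs H))"
proof
  assume "hamiltonian (with_proj H)"
  then obtain u p where
    walk: "pre_digraph.awalk (with_proj H) u p u" and cyc: "pre_digraph.cycle (with_proj H) p"
    and len: "3 \<le> length p" and cover: "set (pawalk_verts u p) = pverts H"
    unfolding hamiltonian_def pre_digraph.hamilton_cycle_def by (auto simp: awalk_verts_with_proj_eq)
  let ?L = "map snd p"
  have ne: "p \<noteq> []" using len by auto
  have verts: "pawalk_verts x p = fst (p ! 0) # map snd p" if "pcas x p y" for x y
    using pre_digraph.awalk_verts_conv'[of "with_proj H" x p y] that ne
    by (simp add: awalk_verts_with_proj_eq cas_with_proj_eq hd_conv_nth)
  have cas: "pcas u p u" and sub: "set p \<subseteq> parcs H"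
    using walk by (auto simp: pre_digraph.awalk_def cas_with_proj_eq)
  have 1: "fst (p ! 0) = u" "snd (p ! (length p - 1)) = u"
    and 2: "\<And>i. Suc i < length p \<Longrightarrow> snd (p ! i) = fst (p ! Suc i)"
    using cas pcas_iff_nth[OF ne] by auto
  have "distinct ?L"
    using cyc verts
    by (auto simp: pre_digraph.cycle_def pre_digraph.awalk_def awalk_verts_with_proj_eq cas_with_proj_eq)
  moreover have "set ?L = pverts H"
  proof -
    have "u \<in> set ?L" using 1 ne by (metis last_conv_nth last_in_set last_map list.map_disc_iff)
    then show ?thesis using cover unfolding verts[OF cas] 1 by (simp add: insert_absorb)
  qed
  moreover have "(?L ! i, ?L ! (Suc i mod length ?L)) \<in> parcs H" if "i < length ?L" for i
  proof -
    let ?j = "Suc i mod length p"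
    have j: "?j < length p" using ne by simp
    have "snd (p ! i) = fst (p ! ?j)"
    proof (cases "Suc i < length p")
      case True
      then show ?thesis using 2 by simp
    next
      case False
      then have "Suc i = length p" using that by simp
      then have "i = length p - 1" "?j = 0" by auto
      then show ?thesis using 1 by simp
    qed
    then have "(snd (p ! i), snd (p ! ?j)) = p ! ?j" by simp
    moreover have "p ! ?j \<in> parcs H" using sub nth_mem[OF j] by blast
    ultimately show ?thesis using j that by (simp del: prod.collapse)
  qed
  ultimately show "\<exists>L. 3 \<le> length L \<and> distinct L \<and> set L = pverts H \<and>
          (\<forall>i<length L. (L ! i, L ! (Suc i mod length L)) \<in> parcs H)"
    using len by (intro exI[of _ ?L]) auto
next
  assume "\<exists>L. 3 \<le> length L \<and> distinct L \<and> set L = pverts H \<and>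
          (\<forall>i<length L. (L ! i, L ! (Suc i mod length L)) \<in> parcs H)"
  then obtain L where len: "3 \<le> length L" and dist: "distinct L" and set: "set L = pverts H"
    and adj: "\<And>i. i < length L \<Longrightarrow> (L ! i, L ! (Suc i mod length L)) \<in> parcs H" by auto
  let ?n = "length L"
  define p where "p = map (\<lambda>i. (L ! i, L ! (Suc i mod ?n))) [0..<?n]"
  have lp: "length p = ?n" by (simp add: p_def)
  have n: "0 < ?n" using len by linarith
  have ne: "p \<noteq> []" using n unfolding lp[symmetric] by (rule length_greater_0_conv[THEN iffD1])
  have cas: "pcas (L ! 0) p (L ! 0)"
    unfolding pcas_iff_nth[OF ne] lp
  proof (intro conjI allI impI)
    show "fst (p ! 0) = L ! 0" using n by (simp add: p_def)
    have "Suc (?n - 1) = ?n" using n by simp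
    then show "snd (p ! (?n - 1)) = L ! 0" using n by (simp add: p_def)
  qed (simp add: p_def)
  have sub: "set p \<subseteq> parcs H" using adj by (auto simp: p_def)
  have L0: "L ! 0 \<in> pverts H" using set nth_mem[OF n] by simp
  then have walk: "pre_digraph.awalk (with_proj H) (L ! 0) p (L ! 0)"
    using cas sub by (simp add: pre_digraph.awalk_def cas_with_proj_eq)
  have "map fst p = L" by (simp add: p_def comp_def map_nth)
  then have verts: "pawalk_verts (L ! 0) p = L @ [snd (last p)]"
    using ne pre_digraph.awalk_verts_conv[of "with_proj H" "L ! 0" p]
    by (simp add: awalk_verts_with_proj_eq)
  have last: "snd (last p) = L ! 0"
    using cas pcas_iff_nth[OF ne] ne by (simp add: last_conv_nth)
  have "tl (L @ [L ! 0]) = rotate1 L" using n by (cases L) auto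
  then have "distinct (tl (pawalk_verts (L ! 0) p))"
    unfolding verts last using dist by simp
  then have "pre_digraph.cycle (with_proj H) p"
    unfolding pre_digraph.cycle_def using walk ne by (auto simp: awalk_verts_with_proj_eq)
  moreover have "set (pawalk_verts (L ! 0) p) = pverts H"
    unfolding verts last using set L0 by auto
  ultimately show "hamiltonian (with_proj H)"
    unfolding hamiltonian_def pre_digraph.hamilton_cycle_def
    unfolding awalk_verts_with_proj_eq
    using walk len lp by (intro exI[of _ "L ! 0"] exI[of _ p]) simp
qed

lemma (in pair_graph) degree_eq_card: "degree G u = card (parcs G `` {u})"
proof -
  have "out_arcs (with_proj G) u = Pair u ` (parcs G `` {u})"
    by (auto simp: out_arcs_def)
  then show ?thesis by (simp add: out_degree_def card_image inj_on_def)
qed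

text \<open>
  Both directions of the main equivalence meet connectivity through a set of vertices that is closed
  under adjacency, never through an explicit path.
\<close>
lemma (in pair_graph) connected_induce_iff:
  shows "connected (with_proj G \<restriction> S) \<longleftrightarrow> S \<noteq> {} \<and>
     (\<forall>W. W \<noteq> {} \<and> W \<subseteq> S \<and> (\<forall>a b. a \<in> W \<and> b \<in> S \<and> (a, b) \<in> parcs G \<longrightarrow> b \<in> W) \<longrightarrow> W = S)"
proof -
  let ?R = "{(a, b) \<in> parcs G. a \<in> S \<and> b \<in> S}"
  have arcs: "parcs (mk_symmetric (with_proj G \<restriction> S)) = ?R"
  proof -
    have "parcs (mk_symmetric (with_proj G \<restriction> S)) =
        (\<Union>e\<in>{e \<in> parcs G. fst e \<in> S \<and> snd e \<in> S}. {(fst e, snd e), (snd e, fst e)})"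
      by (simp add: mk_symmetric_def)
    also have "\<dots> = ?R"
    proof (intro equalityI subsetI)
      fix x assume "x \<in> (\<Union>e\<in>{e \<in> parcs G. fst e \<in> S \<and> snd e \<in> S}. {(fst e, snd e), (snd e, fst e)})"
      then obtain a b where "(a, b) \<in> parcs G" "a \<in> S" "b \<in> S" "x = (a, b) \<or> x = (b, a)" by force
      then show "x \<in> ?R" using arcs_symmetric[of a b] by (elim disjE) simp_all
    next
      fix x assume "x \<in> ?R"
      then show "x \<in> (\<Union>e\<in>{e \<in> parcs G. fst e \<in> S \<and> snd e \<in> S}. {(fst e, snd e), (snd e, fst e)})"
        by (intro UN_I[of x]) auto
    qed
    finally show ?thesis .
  qed
  have "connected (with_proj G \<restriction> S) \<longleftrightarrow>
      S \<noteq> {} \<and> (\<forall>u\<in>S. \<forall>v\<in>S. (u, v) \<in> rtrancl_on S ?R)"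
    unfolding connected_def strongly_connected_def reachable_def with_proj_simps
      pverts_mk_symmetric arcs induce_subgraph_verts ..
  also have "\<dots> \<longleftrightarrow> S \<noteq> {} \<and>
     (\<forall>W. W \<noteq> {} \<and> W \<subseteq> S \<and> (\<forall>a b. a \<in> W \<and> b \<in> S \<and> (a, b) \<in> parcs G \<longrightarrow> b \<in> W) \<longrightarrow> W = S)"
  proof (intro conj_cong refl iffI allI impI ballI)
    fix W
    assume reach: "\<forall>u\<in>S. \<forall>v\<in>S. (u, v) \<in> rtrancl_on S ?R"
      and W: "W \<noteq> {} \<and> W \<subseteq> S \<and> (\<forall>a b. a \<in> W \<and> b \<in> S \<and> (a, b) \<in> parcs G \<longrightarrow> b \<in> W)"
    have sub: "W \<subseteq> S" using W by (elim conjE)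
    have closed: "a \<in> W \<and> b \<in> S \<and> (a, b) \<in> parcs G \<longrightarrow> b \<in> W" for a b
      using W by (elim conjE allE)
    have "W \<noteq> {}" using W by (elim conjE)
    then obtain u where u: "u \<in> W" "u \<in> S" using sub by blast
    have "v \<in> W" if "v \<in> S" for v
    proof -
      have "(u, v) \<in> rtrancl_on S ?R" using reach u that by simp
      then show ?thesis
      proof (induction rule: rtrancl_on_induct)
        case base
        show ?case by (rule u)
      next
        case (step y z)
        then show ?case using closed[of y z] by simp
      qed
    qed
    then have "S \<subseteq> W" by (rule subsetI)
    with sub show "W = S" by (rule subset_antisym)
  next
    fix u v
    assume closed: "\<forall>W. W \<noteq> {} \<and> W \<subseteq> S \<and>
        (\<forall>a b. a \<in> W \<and> b \<in> S \<and> (a, b) \<in> parcs G \<longrightarrow> b \<in> W) \<longrightarrow> W = S"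
      and uv: "u \<in> S" "v \<in> S"
    let ?W = "{v \<in> S. (u, v) \<in> rtrancl_on S ?R}"
    have "?W = S"
    proof (rule closed[rule_format], intro conjI allI impI)
      show "?W \<noteq> {}" using uv by auto
      fix a b
      assume ab: "a \<in> ?W \<and> b \<in> S \<and> (a, b) \<in> parcs G"
      then have "(u, b) \<in> rtrancl_on S ?R"
        using rtrancl_on_into_rtrancl_on[of u a S ?R b] by simp
      then show "b \<in> ?W" using ab by simp
    qed simp
    then have "v \<in> ?W" using uv(2) by (simp only:)
    then show "(u, v) \<in> rtrancl_on S ?R" by simp
  qed
  finally show ?thesis .
qed

section \<open>The contexts of a list of arcs\<close>

text \<open>
  Every inner entry of the list is paired with the tails of its two neighbours. Collecting these
  pairs in a multiset, and each pair of tails in a multiset as well, makes the result invariant under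
  reversal of the list.
\<close>
fun contexts :: "('a \<times> 'a) list \<Rightarrow> (('a \<times> 'a) \<times> 'a multiset) multiset" where
  "contexts (a # b # c # r) = add_mset (b, {#fst a, fst c#}) (contexts (b # c # r))"
| "contexts _ = {#}"

definition cyclic_contexts :: "('a \<times> 'a) list \<Rightarrow> (('a \<times> 'a) \<times> 'a multiset) multiset" where
  "cyclic_contexts L = contexts (last L # L @ [hd L])"

text \<open>
  A list may be cut between two entries if both sides keep a copy of the two entries around the cut,
  since a context looks only one step in each direction.
\<close>
lemma contexts_append: "contexts (xs @ a # b # ys) = contexts (xs @ [a, b]) + contexts (a # b # ys)"
proof (induction xs)
  case (Cons x xs)
  then show ?case by (cases xs; cases "tl xs") auto
qed simp

lemma contexts_rev: "contexts (rev xs) = contexts xs"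
proof (induction xs rule: contexts.induct)
  case (1 a b c r)
  have "contexts (rev (a # b # c # r)) = contexts (rev r @ [c, b]) + contexts [c, b, a]"
    using contexts_append[of "rev r" c b "[a]"] by simp
  also have "\<dots> = contexts (b # c # r) + {#(b, {#fst a, fst c#})#}"
    using 1 by (simp add: add_mset_commute)
  finally show ?case by simp
qed auto

lemma contexts_Cons_cong: "fst a = fst a' \<Longrightarrow> contexts (a # xs) = contexts (a' # xs)"
  by (cases xs; cases "tl xs") auto

lemma contexts_snoc_cong: "fst a = fst a' \<Longrightarrow> contexts (xs @ [a]) = contexts (xs @ [a'])"
  using contexts_Cons_cong[of a a' "rev xs"] contexts_rev[of "xs @ [a]"] contexts_rev[of "xs @ [a']"] by simp

lemma fst_contexts: "image_mset fst (contexts (a # xs @ [b])) = mset xs"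
proof (induction xs arbitrary: a)
  case (Cons x xs)
  then show ?case by (cases xs) auto
qed simp

lemma fst_cyclic_contexts: "image_mset fst (cyclic_contexts L) = mset L"
  by (simp add: cyclic_contexts_def fst_contexts)

lemma contexts_pair: "c \<in># contexts xs \<Longrightarrow> \<exists>x y. snd c = {#x, y#}"
proof (induction xs rule: contexts.induct)
  case (1 a b c' r)
  then show ?case by (cases "c = (b, {#fst a, fst c'#})") auto
qed auto

lemma cyclic_contexts_Cons:
  assumes "R \<noteq> []"
  shows "cyclic_contexts (a # R) = add_mset (a, {#fst (last R), fst (hd R)#}) (contexts (a # R @ [a]))"
  using assms by (cases R) (auto simp: cyclic_contexts_def)

lemma cyclic_contexts_rotate1: "cyclic_contexts (rotate1 L) = cyclic_contexts L"
proof (cases L)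
  case (Cons a R)
  show ?thesis
  proof (cases R rule: rev_cases)
    case (snoc R' l)
    have "cyclic_contexts (rotate1 L) = contexts ((a # R') @ l # a # [hd R])"
      using Cons snoc by (simp add: cyclic_contexts_def hd_append)
    also have "\<dots> = contexts (a # R @ [a]) + contexts [l, a, hd R]"
      by (subst contexts_append) (simp add: snoc)
    also have "\<dots> = cyclic_contexts L"
      using cyclic_contexts_Cons[of R a] by (simp add: Cons snoc)
    finally show ?thesis .
  qed (simp add: Cons)
qed simp

lemma cyclic_contexts_rotate: "cyclic_contexts (rotate n L) = cyclic_contexts L"
  by (induction n) (auto simp: cyclic_contexts_rotate1)

lemma cyclic_contexts_append_commute: "cyclic_contexts (xs @ ys) = cyclic_contexts (ys @ xs)"
  using cyclic_contexts_rotate[of "length xs" "xs @ ys"] by (simp add: rotate_append)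

text \<open>
  The decomposition behind every modification of a tour: cutting the cycle at two entries \<open>a\<close> and
  \<open>b\<close> isolates their two contexts, and the rest depends only on the two stretches in between. By
  \<open>contexts_rev\<close> the rest survives the reversal of a stretch, and by the congruence below it survives
  a change of the heads of \<open>a\<close> and \<open>b\<close>.
\<close>
lemma cyclic_contexts_split:
  assumes "S \<noteq> []" "T \<noteq> []"
  shows "cyclic_contexts (a # S @ b # T) =
    {#(a, {#fst (last T), fst (hd S)#}), (b, {#fst (last S), fst (hd T)#})#}
      + (contexts (a # S @ [b]) + contexts (b # T @ [a]))"
proof -
  obtain S' l where S: "S = S' @ [l]" using assms(1) by (cases S rule: rev_cases) auto
  obtain h T' where T: "T = h # T'" using assms(2) by (cases T) auto
  have "contexts (a # (S @ b # T) @ [a]) = contexts ((a # S') @ l # b # (T @ [a]))" by (simp add: S)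
  also have "\<dots> = contexts (a # S @ [b]) + contexts (l # b # T @ [a])"
    by (subst contexts_append) (simp add: S)
  also have "contexts (l # b # T @ [a]) = add_mset (b, {#fst (last S), fst (hd T)#}) (contexts (b # T @ [a]))"
    by (simp add: S T)
  finally show ?thesis using assms by (subst cyclic_contexts_Cons) auto
qed

lemma contexts_ends_cong:
  assumes "fst a = fst a'" "fst b = fst b'"
  shows "contexts (a # S @ [b]) = contexts (a' # S @ [b'])"
  using contexts_Cons_cong[OF assms(1), of "S @ [b]"] contexts_snoc_cong[OF assms(2), of "a' # S"] by simp

lemma cyclic_contexts_successive:
  "(a, {#fst (last (b # r)), fst b#}) \<in># cyclic_contexts (a # b # r)"
  "\<exists>z. (b, {#fst a, z#}) \<in># cyclic_contexts (a # b # r)"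
  by (cases r; auto simp: cyclic_contexts_def)+

text \<open>
  A pair \<open>(u, z)\<close> occurs as often as the walk steps between \<open>u\<close> and \<open>z\<close>, in either direction, because
  each such step puts \<open>z\<close> into one context at \<open>u\<close>.
\<close>
definition ends :: "(('a \<times> 'a) \<times> 'a multiset) multiset \<Rightarrow> ('a \<times> 'a) multiset" where
  "ends M = \<Sum>\<^sub># (image_mset (\<lambda>c. image_mset (Pair (fst (fst c))) (snd c)) M)"

lemma ends_simps [simp]:
  "ends {#} = {#}"
  "ends (add_mset (a, F) M) = image_mset (Pair (fst a)) F + ends M"
  "ends (M + N) = ends M + ends N"
  by (auto simp: ends_def)

lemma in_ends: "(a, F) \<in># M \<Longrightarrow> z \<in># F \<Longrightarrow> (fst a, z) \<in># ends M"
  by (force simp: ends_def)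

text \<open>
  A tour lists each arc once, so its multiset of contexts is the graph of a function on the arcs.
\<close>
lemma mset_keys_unique:
  assumes M: "image_mset fst M = mset_set A" and "(a, y) \<in># M" "(a, y') \<in># M"
  shows "y = y'"
proof (rule ccontr)
  assume "y \<noteq> y'"
  then have "(a, y') \<in># M - {#(a, y)#}" using assms(2,3) by (simp add: in_diff_count)
  then obtain M' where "M = add_mset (a, y) (add_mset (a, y') M')"
    using assms(2) by (metis insert_DiffM)
  then have "count (image_mset fst M) a \<ge> 2" by simp
  then show False unfolding M by (simp add: count_mset_set' split: if_splits)
qed

lemma mset_function_of_keys:
  assumes "finite A" and M: "image_mset fst M = mset_set A"
  obtains F where "M = image_mset (\<lambda>a. (a, F a)) (mset_set A)"
proof -
  have uniq: "y = y'" if "(a, y) \<in># M" "(a, y') \<in># M" for a y y'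
    using that by (rule mset_keys_unique[OF M])
  define F where "F a = (SOME y. (a, y) \<in># M)" for a
  have "(fst c, F (fst c)) = c" if "c \<in># M" for c
  proof -
    have "(fst c, snd c) \<in># M" using that by simp
    moreover from this have "(fst c, F (fst c)) \<in># M" unfolding F_def by (rule someI)
    ultimately show ?thesis using uniq by (metis prod.collapse)
  qed
  then have "image_mset (\<lambda>c. (fst c, F (fst c))) M = M"
    by (simp add: multiset.map_cong0[of M _ id, simplified])
  moreover have "image_mset (\<lambda>c. (fst c, F (fst c))) M = image_mset (\<lambda>a. (a, F a)) (mset_set A)"
    unfolding M[symmetric] by (simp add: image_mset.compositionality comp_def)
  ultimately have "M = image_mset (\<lambda>a. (a, F a)) (mset_set A)" by (rule trans[OF sym])
  then show ?thesis by (rule that)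
qed

lemma count_ends_function:
  assumes "finite A"
  shows "count (ends (image_mset (\<lambda>a. (a, F a)) (mset_set A))) (u, v)
    = (\<Sum>w\<in>A `` {u}. count (F (u, w)) v)"
proof -
  have cnt: "count (image_mset (Pair t) X) (u, v) = (if t = u then count X v else 0)" for t X
    by (induction X) auto
  have "count (ends (image_mset (\<lambda>a. (a, F a)) (mset_set A))) (u, v)
     = (\<Sum>a\<in>A. if fst a = u then count (F a) v else 0)"
    using assms by (induction A rule: finite_induct) (auto simp: cnt)
  also have "\<dots> = (\<Sum>a\<in>{a\<in>A. fst a = u}. count (F a) v)"
    using assms by (simp add: sum.inter_filter)
  also have "{a\<in>A. fst a = u} = Pair u ` (A `` {u})" by force
  also have "(\<Sum>a\<in>Pair u ` (A `` {u}). count (F a) v) = (\<Sum>w\<in>A `` {u}. count (F (u, w)) v)"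
    by (subst sum.reindex) (auto simp: inj_on_def)
  finally show ?thesis .
qed

definition conflicts :: "(('a \<times> 'a) \<times> 'a multiset) multiset \<Rightarrow> nat" where
  "conflicts M = size {#c \<in># M. snd (fst c) \<in># snd c#}"

lemma conflicts_simps [simp]:
  "conflicts {#} = 0"
  "conflicts (add_mset (a, F) M) = (if snd a \<in># F then 1 else 0) + conflicts M"
  "conflicts (M + N) = conflicts M + conflicts N"
  by (auto simp: conflicts_def)

lemma conflicts_eq_0_iff: "conflicts M = 0 \<longleftrightarrow> (\<forall>(a, F)\<in>#M. snd a \<notin># F)"
proof (induction M)
  case (add c M)
  then show ?case by (cases c) auto
qed simp

section \<open>Tours\<close>

context pair_graph
begin

lemma finite_out_neighbours: "finite (parcs G `` {u})"
proof (rule finite_subset[OF _ pair_finite_verts])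
  show "parcs G `` {u} \<subseteq> pverts G" using in_arcsD2 by blast
qed

text \<open>
  Partial tours, on a symmetric set of arcs, are included so that tours can be grown arc by
  arc. The equation on \<open>ends\<close> says that every edge is traversed exactly twice, with no condition on the
  two directions. It also makes the tails of consecutive arcs adjacent.
\<close>
definition tour :: "('a \<times> 'a) list \<Rightarrow> bool" where
  "tour L \<longleftrightarrow> distinct L \<and> set L \<subseteq> parcs G \<and> (\<forall>(u, v)\<in>set L. (v, u) \<in> set L) \<and>
     ends (cyclic_contexts L) = mset L + mset L \<and>
     (\<forall>c\<in>#cyclic_contexts L. degree G (fst (fst c)) = 2 \<longrightarrow> (\<exists>x. snd c = {#x, x#}))"

lemma tour_context:
  assumes "tour L" "(a, F) \<in># cyclic_contexts L" "z \<in># F"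
  shows "(fst a, z) \<in> parcs G"
proof -
  have "(fst a, z) \<in># ends (cyclic_contexts L)" using assms(2,3) by (rule in_ends)
  then show ?thesis using assms(1) by (auto simp: tour_def)
qed

lemma tour_degree_two:
  assumes "tour L" "(a, F) \<in># cyclic_contexts L" "degree G (fst a) = 2"
  shows "\<exists>x. F = {#x, x#}"
proof -
  have "\<forall>c\<in>#cyclic_contexts L. degree G (fst (fst c)) = 2 \<longrightarrow> (\<exists>x. snd c = {#x, x#})"
    using assms(1) unfolding tour_def by (elim conjE)
  from bspec[OF this assms(2)] show ?thesis using assms(3) by simp
qed

lemma tour_cong:
  assumes "tour L" "mset L' = mset L" "cyclic_contexts L' = cyclic_contexts L"
  shows "tour L'"
  using assms mset_eq_setD[OF assms(2)] mset_eq_imp_distinct_iff[OF assms(2)]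
  unfolding tour_def by metis

lemma tour_starting_at:
  assumes "tour L" "a \<in> set L"
  obtains R where "R \<noteq> []" "mset (a # R) = mset L" "cyclic_contexts (a # R) = cyclic_contexts L" "tour (a # R)"
proof -
  obtain xs ys where L: "L = xs @ a # ys" using assms(2) by (meson split_list)
  let ?R = "ys @ xs"
  have 1: "mset (a # ?R) = mset L" "cyclic_contexts (a # ?R) = cyclic_contexts L"
    using cyclic_contexts_append_commute[of xs "a # ys"] by (auto simp: L)
  have "(snd a, fst a) \<in> set L" "(snd a, fst a) \<noteq> a"
    using assms no_loops' by (cases a; fastforce simp: tour_def)+
  then have "?R \<noteq> []" by (auto simp: L)
  then show ?thesis using that 1 tour_cong[OF assms(1) 1] by blast
qed

text \<open>
  Two arcs with the same tail are never neighbours in a tour, because \<open>G\<close> has no loops. Hence both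
  stretches between them are nonempty.
\<close>
lemma tour_split:
  assumes "tour L" "a \<in> set L" "b \<in> set L" "a \<noteq> b" "fst a = fst b"
  obtains S T where "S \<noteq> []" "T \<noteq> []" "mset (a # S @ b # T) = mset L"
    "cyclic_contexts (a # S @ b # T) = cyclic_contexts L" "tour (a # S @ b # T)"
proof -
  obtain R where R: "R \<noteq> []" "mset (a # R) = mset L" "cyclic_contexts (a # R) = cyclic_contexts L" "tour (a # R)"
    using tour_starting_at[OF assms(1,2)] .
  have "b \<in> set R" using mset_eq_setD[OF R(2)] assms(3,4) by auto
  then obtain S T where ST: "R = S @ b # T" by (meson split_list)
  have "(a, {#fst (last R), fst (hd R)#}) \<in># cyclic_contexts (a # R)"
    using R(1) by (simp add: cyclic_contexts_Cons)
  then have adj: "(fst a, fst (last R)) \<in> parcs G" "(fst a, fst (hd R)) \<in> parcs G"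
    using tour_context[OF R(4)] by auto
  have "S \<noteq> []" "T \<noteq> []"
    using adj no_loops'[of "fst a" "fst a"] assms(5) by (auto simp: ST)
  then show ?thesis using that R unfolding ST by blast
qed

lemma tour_single_edge:
  assumes "(a, b) \<in> parcs G"
  shows "tour [(a, b), (b, a)]"
  using assms no_loops'[OF assms] arcs_symmetric[OF assms]
  by (auto simp: tour_def cyclic_contexts_def)

text \<open>
  The walk \<open>\<dots> a \<dots>\<close> becomes \<open>\<dots> a, b, a \<dots>\<close>. The new visits to \<open>b\<close> and \<open>a\<close> are labelled with the new arcs, and
  the only old context that changes is one at \<open>a\<close>. This is why the degree of \<open>a\<close> must differ from
  two, whereas \<open>b\<close> is passed as \<open>a, b, a\<close> and may have any degree.
\<close>
lemma tour_insert_excursion: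
  assumes L: "tour L" and ab: "(a, b) \<in> parcs G" "(a, b) \<notin> set L"
    and a: "(a, v) \<in> set L" "degree G a \<noteq> 2"
  shows "\<exists>L'. tour L' \<and> length L < length L'"
proof -
  obtain R where R: "R \<noteq> []" "mset ((a, v) # R) = mset L" "tour ((a, v) # R)"
    using tour_starting_at[OF L a(1)] by metis
  let ?L' = "(a, v) # (b, a) # (a, b) # R"
  have set: "set ((a, v) # R) = set L" using R(2) by (rule mset_eq_setD)
  have ba: "(b, a) \<notin> set L" using L ab by (auto simp: tour_def)
  have contexts: "contexts ((a, b) # R @ [(a, v)]) = contexts ((a, v) # R @ [(a, v)])"
    by (rule contexts_Cons_cong) simp
  have old: "cyclic_contexts ((a, v) # R) =
      add_mset ((a, v), {#fst (last R), fst (hd R)#}) (contexts ((a, v) # R @ [(a, v)]))"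
    using R(1) by (rule cyclic_contexts_Cons)
  have new: "cyclic_contexts ?L' =
      {#((a, v), {#fst (last R), b#}), ((b, a), {#a, a#}), ((a, b), {#b, fst (hd R)#})#}
        + contexts ((a, v) # R @ [(a, v)])"
    using R(1) contexts by (cases R) (auto simp: cyclic_contexts_def)
  have "tour ?L'"
    unfolding tour_def
  proof (intro conjI)
    show "distinct ?L'"
      using R(3) set ab ba no_loops'[OF ab(1)] by (auto simp: tour_def)
    show "set ?L' \<subseteq> parcs G"
      using R(3) ab arcs_symmetric[OF ab(1)] by (auto simp: tour_def)
    show "\<forall>(u, v)\<in>set ?L'. (v, u) \<in> set ?L'"
      using R(3) by (auto simp: tour_def)
    have "ends (cyclic_contexts ((a, v) # R)) = mset ((a, v) # R) + mset ((a, v) # R)"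
      using R(3) by (simp add: tour_def)
    then show "ends (cyclic_contexts ?L') = mset ?L' + mset ?L'"
      unfolding old new by simp
    show "\<forall>c\<in>#cyclic_contexts ?L'. degree G (fst (fst c)) = 2 \<longrightarrow> (\<exists>x. snd c = {#x, x#})"
      using R(3) a(2) unfolding tour_def old new by auto
  qed
  moreover have "length ((a, v) # R) = length L" using R(2) by (rule mset_eq_length)
  ultimately show ?thesis by (intro exI[of _ ?L']) auto
qed

text \<open>
  In a longest tour, no excursion can be inserted, so all arcs at visited vertices of degree other
  than two are present. Among the vertices of degree other than two, the visited ones are thus closed under
  adjacency, so by connectivity all of them are visited. Every edge has such an end, since vertices of degree
  two are pairwise nonadjacent.
\<close>
lemma exists_full_tour:
  assumes edge: "parcs G \<noteq> {}"
    and indep: "\<forall>u\<in>pverts G. \<forall>v\<in>pverts G. degree G u = 2 \<and> degree G v = 2 \<longrightarrow> (u, v) \<notin> parcs G"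
    and conn: "connected (with_proj G \<restriction> (pverts G - {v \<in> pverts G. degree G v = 2}))"
  shows "\<exists>L. tour L \<and> set L = parcs G"
proof -
  let ?S = "pverts G - {v \<in> pverts G. degree G v = 2}"
  obtain a b where "(a, b) \<in> parcs G" using edge by auto
  then have "tour [(a, b), (b, a)]" by (rule tour_single_edge)
  moreover have "length L \<le> card (parcs G)" if "tour L" for L
    using that card_mono[OF pair_finite_arcs, of "set L"] by (simp add: tour_def distinct_card)
  ultimately obtain L where L: "tour L" and max: "\<And>L'. tour L' \<Longrightarrow> length L' \<le> length L"
    using ex_has_greatest_nat[of tour "[(a, b), (b, a)]" length "Suc (card (parcs G))"] by (auto simp: less_Suc_eq_le)
  have "L \<noteq> []" using max[OF \<open>tour [(a, b), (b, a)]\<close>] by auto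
  have sub: "set L \<subseteq> parcs G" and sym: "\<And>u v. (u, v) \<in> set L \<Longrightarrow> (v, u) \<in> set L"
    using L by (auto simp: tour_def)
  let ?W = "{u \<in> ?S. \<exists>v. (u, v) \<in> set L}"
  have full: "(u, v) \<in> set L" if "u \<in> ?W" "(u, v) \<in> parcs G" for u v
    using tour_insert_excursion[OF L, of u v] max that in_arcsD1 by fastforce
  have large: "u \<in> ?S \<or> v \<in> ?S" if "(u, v) \<in> parcs G" for u v
    using that indep in_arcsD1 in_arcsD2 by blast
  have "?W \<noteq> {}"
  proof -
    obtain u v where uv: "(u, v) \<in> set L" using \<open>L \<noteq> []\<close> by (cases L) auto
    then show ?thesis using sub sym[OF uv] large[of u v] by blast
  qed
  moreover have "\<forall>a b. a \<in> ?W \<and> b \<in> ?S \<and> (a, b) \<in> parcs G \<longrightarrow> b \<in> ?W"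
    using full sym by blast
  ultimately have W: "?W = ?S"
    using conn connected_induce_iff[of ?S] by (metis (no_types, lifting) Diff_subset mem_Collect_eq subsetI)
  have "(u, v) \<in> set L" if uv: "(u, v) \<in> parcs G" for u v
    using large[OF uv] full[of u v] full[of v u] sym[of v u] arcs_symmetric[OF uv] uv W by blast
  then show ?thesis using L sub by auto
qed

section \<open>Exchanging labels and reversing stretches\<close>

lemma tour_context_keys:
  assumes "tour L"
  shows "image_mset fst (cyclic_contexts L) = mset_set (set L)"
  using assms by (simp add: fst_cyclic_contexts tour_def mset_set_set)

lemma tour_split_contexts:
  assumes L: "tour L" and ab: "a \<noteq> b" "fst a = fst b"
    and F: "(a, F) \<in># cyclic_contexts L" "(b, F') \<in># cyclic_contexts L"
  obtains S T where "S \<noteq> []" "T \<noteq> []" "mset (a # S @ b # T) = mset L"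
    "F = {#fst (last T), fst (hd S)#}" "F' = {#fst (last S), fst (hd T)#}"
    "cyclic_contexts L = {#(a, F), (b, F')#} + (contexts (a # S @ [b]) + contexts (b # T @ [a]))"
proof -
  have "a \<in># mset L" "b \<in># mset L"
    unfolding fst_cyclic_contexts[of L, symmetric] using F by force+
  then obtain S T where ST: "S \<noteq> []" "T \<noteq> []" "mset (a # S @ b # T) = mset L"
    "cyclic_contexts (a # S @ b # T) = cyclic_contexts L"
    using tour_split[OF L _ _ ab] by (metis set_mset_mset)
  have C: "cyclic_contexts L =
    {#(a, {#fst (last T), fst (hd S)#}), (b, {#fst (last S), fst (hd T)#})#}
      + (contexts (a # S @ [b]) + contexts (b # T @ [a]))"
    using cyclic_contexts_split[OF ST(1,2), of a b] ST(4) by simp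
  have "F = {#fst (last T), fst (hd S)#}"
    by (rule mset_keys_unique[OF tour_context_keys[OF L] F(1)]) (simp add: C)
  moreover have "F' = {#fst (last S), fst (hd T)#}"
    by (rule mset_keys_unique[OF tour_context_keys[OF L] F(2)]) (simp add: C)
  ultimately show ?thesis using that ST C by metis
qed

text \<open>
  Redistributing the members of two contexts at one vertex keeps the number of traversals of every
  edge, so only the condition at vertices of degree two needs attention.
\<close>
lemma tour_rearrange:
  assumes L: "tour L" and L': "mset L' = mset L"
    and C: "cyclic_contexts L = {#(a, F), (b, F')#} + M" "cyclic_contexts L' = {#(c, X), (d, Y)#} + M"
    and fst: "fst b = fst a" "fst c = fst a" "fst d = fst a" and sum: "X + Y = F + F'"
    and two: "degree G (fst a) = 2 \<Longrightarrow> (\<exists>x. X = {#x, x#}) \<and> (\<exists>x. Y = {#x, x#})"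
  shows "tour L'"
proof -
  have set: "set L' = set L" using L' by (rule mset_eq_setD)
  have "image_mset (Pair (fst a)) X + image_mset (Pair (fst a)) Y =
        image_mset (Pair (fst a)) F + image_mset (Pair (fst a)) F'"
    using sum by (metis image_mset_union)
  then have "ends (cyclic_contexts L') = ends (cyclic_contexts L)"
    unfolding C by (simp add: fst add.assoc[symmetric])
  then have "ends (cyclic_contexts L') = mset L' + mset L'"
    using L by (simp add: tour_def L')
  moreover have "\<forall>c\<in>#cyclic_contexts L'. degree G (fst (fst c)) = 2 \<longrightarrow> (\<exists>x. snd c = {#x, x#})"
  proof -
    have "\<forall>c\<in>#M. degree G (fst (fst c)) = 2 \<longrightarrow> (\<exists>x. snd c = {#x, x#})"
      using L unfolding tour_def C by simp
    then show ?thesis using two unfolding C by (simp add: fst)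
  qed
  ultimately show ?thesis
    using L unfolding tour_def set mset_eq_imp_distinct_iff[OF L'] by simp
qed

text \<open>
  Exchanging two arcs with the same tail leaves the walk as it is and only relabels two visits. The
  balance of conflicts is stated with sums on both sides to avoid subtraction.
\<close>
lemma tour_swap_labels:
  assumes L: "tour L" and ab: "a \<noteq> b" "fst a = fst b"
    and F: "(a, F) \<in># cyclic_contexts L" "(b, F') \<in># cyclic_contexts L"
  shows "\<exists>L'. tour L' \<and> set L' = set L \<and>
     conflicts (cyclic_contexts L') + conflicts {#(a, F), (b, F')#} =
     conflicts (cyclic_contexts L) + conflicts {#(b, F), (a, F')#}"
proof -
  obtain S T where ST: "S \<noteq> []" "T \<noteq> []" "mset (a # S @ b # T) = mset L"
    and FF: "F = {#fst (last T), fst (hd S)#}" "F' = {#fst (last S), fst (hd T)#}"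
    and C: "cyclic_contexts L = {#(a, F), (b, F')#} + (contexts (a # S @ [b]) + contexts (b # T @ [a]))"
    using tour_split_contexts[OF L ab F] .
  let ?L' = "b # S @ a # T"
  have C': "cyclic_contexts ?L' = {#(b, F), (a, F')#} + (contexts (a # S @ [b]) + contexts (b # T @ [a]))"
  proof -
    have "contexts (b # S @ [a]) = contexts (a # S @ [b])" "contexts (a # T @ [b]) = contexts (b # T @ [a])"
      using ab(2) by (intro contexts_ends_cong; simp)+
    then show ?thesis using cyclic_contexts_split[OF ST(1,2), of b a] by (simp add: FF)
  qed
  have m: "mset ?L' = mset L" using ST(3) by (simp add: add_mset_commute)
  have "tour ?L'"
  proof (rule tour_rearrange[OF L m C C'])
    assume "degree G (fst a) = 2"
    then show "(\<exists>x. F = {#x, x#}) \<and> (\<exists>x. F' = {#x, x#})"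
      using tour_degree_two[OF L F(1)] tour_degree_two[OF L F(2)] ab(2) by simp
  qed (simp_all add: ab(2))
  then show ?thesis
    using mset_eq_setD[OF m] by (intro exI[of _ ?L']) (simp add: C C')
qed

text \<open>
  Reversing the stretch \<open>S\<close> between two visits to the same vertex joins the step before \<open>S\<close> to the
  last step of \<open>S\<close>, and the first step of \<open>S\<close> to the one after. So the two contexts exchange one member
  each. Both visits may be relabelled in passing, and the conclusion fixes the labels that the new
  contexts \<open>{x, k}\<close> and \<open>{p, k}\<close> call for when \<open>a = ux\<close> and \<open>b = up\<close>.
\<close>
lemma tour_reverse_segment:
  assumes L: "tour L" and ab: "a \<noteq> b" "fst a = fst b" and deg: "degree G (fst a) \<noteq> 2"
    and F: "(a, {#x, p#}) \<in># cyclic_contexts L" "(b, {#k, k#}) \<in># cyclic_contexts L"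
  shows "\<exists>L'. tour L' \<and> set L' = set L \<and>
     conflicts (cyclic_contexts L') + conflicts {#(a, {#x, p#}), (b, {#k, k#})#} =
     conflicts (cyclic_contexts L) + conflicts {#(b, {#x, k#}), (a, {#p, k#})#}"
proof -
  obtain S T where ST: "S \<noteq> []" "T \<noteq> []" "mset (a # S @ b # T) = mset L"
    and FF: "{#x, p#} = {#fst (last T), fst (hd S)#}" "{#k, k#} = {#fst (last S), fst (hd T)#}"
    and C: "cyclic_contexts L = {#(a, {#x, p#}), (b, {#k, k#})#} + (contexts (a # S @ [b]) + contexts (b # T @ [a]))"
    using tour_split_contexts[OF L ab F] .
  have k: "fst (last S) = k" "fst (hd T) = k"
    using FF(2) by (auto simp: add_eq_conv_ex)
  \<comment> \<open>Which visit ends up between \<open>x\<close> and \<open>k\<close> depends on the direction in which the walk passes \<open>x, u, p\<close>;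
    the arcs \<open>c\<close> and \<open>d\<close> are \<open>a\<close> and \<open>b\<close> in the order that gives this visit the arc \<open>b\<close>.\<close>
  obtain c d where cd: "c = a \<and> d = b \<or> c = b \<and> d = a"
    and C2: "{#(c, {#fst (last T), k#}), (d, {#fst (hd S), k#})#} = {#(b, {#x, k#}), (a, {#p, k#})#}"
  proof (cases "fst (last T) = x")
    case True
    then have "fst (hd S) = p" using FF(1) by simp
    then show ?thesis using that[of b a] True by simp
  next
    case False
    then have "fst (last T) = p" "fst (hd S) = x" using FF(1) by (auto simp: add_eq_conv_ex)
    then show ?thesis using that[of a b] by (simp add: add_mset_commute)
  qed
  let ?L' = "c # rev S @ d # T"
  have "contexts (c # rev S @ [d]) = contexts (a # S @ [b])"
  proof -
    have "contexts (c # rev S @ [d]) = contexts (d # S @ [c])"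
      using contexts_rev[of "d # S @ [c]"] by simp
    also have "\<dots> = contexts (a # S @ [b])"
      using cd ab(2) by (intro contexts_ends_cong) auto
    finally show ?thesis .
  qed
  moreover have "contexts (d # T @ [c]) = contexts (b # T @ [a])"
    using cd ab(2) by (intro contexts_ends_cong) auto
  ultimately have C': "cyclic_contexts ?L' =
      {#(b, {#x, k#}), (a, {#p, k#})#} + (contexts (a # S @ [b]) + contexts (b # T @ [a]))"
    unfolding C2[symmetric] using cyclic_contexts_split[of "rev S" T c d] ST(1,2)
    by (simp add: k last_rev hd_rev)
  have m: "mset ?L' = mset L" using ST(3) cd by (auto simp: add_mset_commute)
  have "tour ?L'"
    by (rule tour_rearrange[OF L m C C']) (use ab deg in auto)
  then show ?thesis
    using mset_eq_setD[OF m] by (intro exI[of _ ?L']) (simp add: C C')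
qed

text \<open>
  At a conflict \<open>ux\<close> with context \<open>{x, p}\<close>, an exchange with \<open>uw\<close> can fail to be an improvement only if \<open>w = p\<close> or
  if \<open>x\<close> lies in the context of \<open>uw\<close>. The latter happens for at most one \<open>w\<close>, as \<open>x\<close> occurs
  twice in all contexts at \<open>u\<close> together. So failure of all exchanges leaves room for one \<open>p\<close> and one
  such \<open>w = k\<close> besides \<open>x\<close>, and counting occurrences then determines all three contexts.
\<close>
lemma tour_improve:
  assumes L: "tour L" and full: "set L = parcs G" and deg: "\<forall>v\<in>pverts G. degree G v \<ge> 2"
    and conf: "conflicts (cyclic_contexts L) > 0"
  shows "\<exists>L'. tour L' \<and> set L' = parcs G \<and> conflicts (cyclic_contexts L') < conflicts (cyclic_contexts L)"
proof (rule ccontr)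
  assume none: "\<not> ?thesis"
  have best: "conflicts (cyclic_contexts L) \<le> conflicts (cyclic_contexts L')"
    if "tour L'" "set L' = set L" for L'
  proof (rule leI)
    have "set L' = parcs G" using that full by simp
    with none that show "\<not> conflicts (cyclic_contexts L') < conflicts (cyclic_contexts L)" by blast
  qed
  obtain F where F: "cyclic_contexts L = image_mset (\<lambda>a. (a, F a)) (mset_set (parcs G))"
    using mset_function_of_keys[OF pair_finite_arcs tour_context_keys[OF L, unfolded full]] .
  have inF: "(a, F a) \<in># cyclic_contexts L" if "a \<in> parcs G" for a
    using that pair_finite_arcs by (simp add: F)
  have "\<not> (\<forall>(a, X)\<in>#cyclic_contexts L. snd a \<notin># X)"
    using conf conflicts_eq_0_iff[of "cyclic_contexts L"] by simp
  then obtain a X where aX: "(a, X) \<in># cyclic_contexts L" "snd a \<in># X" by blast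
  obtain u x where a: "a = (u, x)" by (cases a)
  have ux: "(u, x) \<in> parcs G" and conflict: "x \<in># F (u, x)"
    using aX pair_finite_arcs unfolding F a by auto
  define N where "N = parcs G `` {u}"
  have finN: "finite N" unfolding N_def by (rule finite_out_neighbours)
  have xN: "x \<in> N" using ux by (simp add: N_def)
  have cnt: "(\<Sum>w\<in>N. count (F (u, w)) v) = (if v \<in> N then 2 else 0)" for v
  proof -
    have "ends (cyclic_contexts L) = mset_set (parcs G) + mset_set (parcs G)"
      using L mset_set_set[of L] full by (simp add: tour_def)
    then have "count (ends (cyclic_contexts L)) (u, v) = (if (u, v) \<in> parcs G then 2 else 0)"
      using pair_finite_arcs by (simp add: count_mset_set')
    then show ?thesis
      unfolding F count_ends_function[OF pair_finite_arcs] by (simp add: N_def)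
  qed
  have pair: "\<exists>y z. F (u, w) = {#y, z#}" if "w \<in> N" for w
  proof -
    have "((u, w), F (u, w)) \<in># cyclic_contexts L" using that by (intro inF) (simp add: N_def)
    from contexts_pair[OF this[unfolded cyclic_contexts_def]] show ?thesis by simp
  qed
  obtain p where Fx: "F (u, x) = {#x, p#}"
  proof -
    obtain y z where yz: "F (u, x) = {#y, z#}" using pair[OF xN] by auto
    then have "x = y \<or> x = z" using conflict by auto
    then show thesis using that[of z] that[of y] yz by (auto simp: add_mset_commute)
  qed
  \<comment> \<open>For \<open>w \<noteq> p\<close> the exchange removes the conflict of the first visit, so without an overall gain it
    creates a conflict at the second that was not there before.\<close>
  have stuck: "w = p \<or> x \<in># F (u, w) \<and> w \<notin># F (u, w)" if "w \<in> N" "w \<noteq> x" for w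
  proof -
    have uw: "(u, w) \<in> parcs G" using that by (simp add: N_def)
    have ne: "(u, x) \<noteq> (u, w)" using that by simp
    obtain L' where "tour L'" "set L' = set L"
      "conflicts (cyclic_contexts L') + conflicts {#((u, x), F (u, x)), ((u, w), F (u, w))#} =
       conflicts (cyclic_contexts L) + conflicts {#((u, w), F (u, x)), ((u, x), F (u, w))#}"
      using tour_swap_labels[OF L ne _ inF[OF ux] inF[OF uw]] by auto
    then show ?thesis using best[of L'] that by (auto simp: Fx split: if_splits)
  qed
  have rest: "(\<Sum>w\<in>N. count (F (u, w)) v) = count (F (u, x)) v + (\<Sum>w\<in>N - {x}. count (F (u, w)) v)" for v
    using sum.remove[OF finN xN] by simp
  have cardN: "card N = degree G u" by (simp add: N_def degree_eq_card)
  have two: "2 \<le> card N" using bspec[OF deg in_arcsD1[OF ux]] cardN by simp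
  have le: "count (F (u, k)) x \<le> (\<Sum>w\<in>N - {x}. count (F (u, w)) x)" if "k \<in> N - {x}" for k
    using finN that by (intro member_le_sum) auto
  have cntx: "(\<Sum>w\<in>N. count (F (u, w)) x) = 2" using cnt[of x] xN by simp
  \<comment> \<open>If \<open>p = x\<close>, both occurrences of \<open>x\<close> are used up and any second neighbour gives an improvement.\<close>
  have px: "p \<noteq> x"
  proof
    assume "p = x"
    have "\<not> N \<subseteq> {x}" using two card_mono[of "{x}" N] by auto
    then obtain w where w: "w \<in> N - {x}" by auto
    then have "x \<in># F (u, w)" using stuck[of w] \<open>p = x\<close> by auto
    then have "0 < count (F (u, w)) x" by (simp only: count_greater_zero_iff)
    moreover have "count (F (u, x)) x = 2" by (simp add: Fx \<open>p = x\<close>)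
    ultimately show False using le[OF w] cntx rest[of x] by linarith
  qed
  have pN: "p \<in> N"
    using cnt[of p] rest[of p] by (auto simp: Fx split: if_splits)
  \<comment> \<open>Vertices of degree two are passed as \<open>y, u, y\<close>, whereas the context at hand has two distinct members.\<close>
  have "card N \<noteq> 2"
  proof
    assume "card N = 2"
    then have "\<exists>y. F (u, x) = {#y, y#}"
      using tour_degree_two[OF L inF[OF ux]] cardN by simp
    then show False using px by (auto simp: Fx add_eq_conv_ex)
  qed
  then have "\<not> N \<subseteq> {x, p}"
    using two card_mono[of "{x, p}" N] px by auto
  then obtain k where k: "k \<in> N" "k \<noteq> x" "k \<noteq> p" by auto
  then have Fk: "x \<in># F (u, k)" "k \<notin># F (u, k)" using stuck by auto
  \<comment> \<open>A fourth neighbour \<open>l\<close> would be a third visit with \<open>x\<close> in its context.\<close>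
  have N: "N = {x, p, k}"
  proof (rule ccontr)
    assume "N \<noteq> {x, p, k}"
    then obtain l where l: "l \<in> N" "l \<noteq> x" "l \<noteq> p" "l \<noteq> k" using xN pN k(1) by auto
    then have "x \<in># F (u, l)" using stuck by auto
    moreover have "(\<Sum>w\<in>{k, l}. count (F (u, w)) x) \<le> (\<Sum>w\<in>N - {x}. count (F (u, w)) x)"
      using finN k l by (intro sum_mono2) auto
    moreover have "(\<Sum>w\<in>{k, l}. count (F (u, w)) x) = count (F (u, k)) x + count (F (u, l)) x"
      using l(4) by simp
    moreover have "0 < count (F (u, x)) x" by (simp add: Fx)
    ultimately show False
      using Fk(1) cntx rest[of x] unfolding count_greater_zero_iff[symmetric] by linarith
  qed
  have total: "count (F (u, x)) v + count (F (u, p)) v + count (F (u, k)) v = (if v \<in> N then 2 else 0)" for v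
    using cnt[of v] k px by (simp add: N)
  \<comment> \<open>The context of \<open>uk\<close> contains \<open>x\<close> but not \<open>k\<close>, and \<open>x\<close> only once, so it is \<open>{x, p}\<close>. What remains of the double
    supply of \<open>x, p, k\<close> is \<open>{k, k}\<close>.\<close>
  have "F (u, p) = {#k, k#}"
  proof -
    obtain y z where yz: "F (u, k) = {#y, z#}" using pair[OF k(1)] by auto
    obtain s t where st: "F (u, p) = {#s, t#}" using pair[OF pN] by auto
    have mem: "y \<in> N" "z \<in> N" "s \<in> N" "t \<in> N"
      using total[of y] total[of z] total[of s] total[of t]
      by (auto simp: yz st split: if_splits)
    show ?thesis
      using total[of x] total[of p] total[of k] mem Fk k px
      unfolding Fx yz st N by (auto split: if_splits)
  qed
  moreover have up: "(u, p) \<in> parcs G" using pN by (simp add: N_def)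
  ultimately obtain L' where "tour L'" "set L' = set L"
    "conflicts (cyclic_contexts L') + conflicts {#((u, x), {#x, p#}), ((u, p), {#k, k#})#} =
     conflicts (cyclic_contexts L) + conflicts {#((u, p), {#x, k#}), ((u, x), {#p, k#})#}"
    using tour_reverse_segment[OF L, of "(u, x)" "(u, p)" x p k] inF[OF ux] inF[OF up] Fx px
      \<open>card N \<noteq> 2\<close> cardN by (simp, blast)
  then show False using best[of L'] px k by auto
qed

section \<open>Sufficiency\<close>

text \<open>
  For consecutive arcs \<open>a\<close>, \<open>b\<close>, the tail of \<open>b\<close> lies in the context of \<open>a\<close> and the tail of \<open>a\<close> in that of
  \<open>b\<close>. Absence of conflicts at both therefore makes them adjacent in \<open>X(G)\<close>.
\<close>
lemma hamiltonian_if_conflict_free: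
  assumes L: "tour L" and full: "set L = parcs G" and conf: "conflicts (cyclic_contexts L) = 0"
    and len: "3 \<le> length L"
  shows "hamiltonian (with_proj (three_arc_graph G))"
  unfolding hamiltonian_iff_cyclic_list
proof (intro exI conjI allI impI)
  show "distinct L" using L by (simp add: tour_def)
  show "set L = pverts (three_arc_graph G)" using full by (simp add: three_arc_graph_def)
  have ok: "snd a \<notin># F" if "(a, F) \<in># cyclic_contexts L" for a F
    using that conf unfolding conflicts_eq_0_iff by blast
  fix i assume i: "i < length L"
  let ?a = "L ! i" and ?b = "L ! (Suc i mod length L)"
  obtain a b r where rot: "rotate i L = a # b # r"
    using len by (metis One_nat_def Suc_le_length_iff length_rotate numeral_3_eq_3)
  have "L \<noteq> []" using i by auto
  then have a: "a = ?a" using nth_rotate[of 0 L i] rot i by simp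
  have b: "b = ?b" using nth_rotate[of 1 L i] rot i len by simp
  obtain y z where ctx: "(?a, {#y, fst ?b#}) \<in># cyclic_contexts L" "(?b, {#fst ?a, z#}) \<in># cyclic_contexts L"
    using cyclic_contexts_successive[where a = a and b = b and r = r] cyclic_contexts_rotate[of i L]
    unfolding rot a b by metis
  have "snd ?a \<noteq> fst ?b" "snd ?b \<noteq> fst ?a" using ok[OF ctx(1)] ok[OF ctx(2)] by auto
  moreover have "(fst ?a, fst ?b) \<in> parcs G" using tour_context[OF L ctx(1)] by simp
  moreover have "Suc i mod length L < length L" using \<open>L \<noteq> []\<close> by simp
  then have "?a \<in> parcs G" "?b \<in> parcs G" using full nth_mem i by blast+
  moreover from this have "(snd ?a, fst ?a) \<in> parcs G" using arcs_symmetric by simp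
  ultimately show "(?a, ?b) \<in> parcs (three_arc_graph G)"
    unfolding three_arc_graph_def three_arc_def
    by (cases "L ! i"; cases "L ! (Suc i mod length L)") auto
qed (fact len)

theorem three_arc_graph_hamiltonian:
  assumes deg: "\<forall>v\<in>pverts G. degree G v \<ge> 2"
    and indep: "\<forall>u\<in>pverts G. \<forall>v\<in>pverts G. degree G u = 2 \<and> degree G v = 2 \<longrightarrow> (u, v) \<notin> parcs G"
    and conn: "connected (with_proj G \<restriction> (pverts G - {v \<in> pverts G. degree G v = 2}))"
  shows "hamiltonian (with_proj (three_arc_graph G))"
proof -
  obtain v where v: "v \<in> pverts G"
    using conn connected_induce_iff[of "pverts G - {v \<in> pverts G. degree G v = 2}"] by auto
  have "2 \<le> card (parcs G `` {v})" using deg v degree_eq_card by simp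
  then obtain x y where xy: "(v, x) \<in> parcs G" "(v, y) \<in> parcs G" "x \<noteq> y"
    by (auto simp: numeral_2_eq_2 card_le_Suc_iff)
  then have edge: "parcs G \<noteq> {}" by auto
  \<comment> \<open>A Hamilton cycle must have at least three vertices.\<close>
  have "card {(v, x), (v, y), (x, v)} \<le> card (parcs G)"
    using xy arcs_symmetric[OF xy(1)] by (intro card_mono pair_finite_arcs) auto
  then have three: "3 \<le> card (parcs G)" using xy(3) no_loops'[OF xy(1)] by auto
  let ?P = "\<lambda>L. tour L \<and> set L = parcs G"
  obtain L0 where "?P L0" using exists_full_tour[OF edge indep conn] by auto
  then obtain L where L: "?P L"
    and min: "\<And>L'. ?P L' \<Longrightarrow> conflicts (cyclic_contexts L) \<le> conflicts (cyclic_contexts L')"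
    using ex_has_least_nat[of ?P L0 "\<lambda>L. conflicts (cyclic_contexts L)"] by auto
  have "conflicts (cyclic_contexts L) = 0"
    using tour_improve[of L] L min deg by (meson gr0I not_le)
  moreover have "length L = card (parcs G)"
    using L by (metis distinct_card tour_def)
  ultimately show ?thesis using L three hamiltonian_if_conflict_free[of L] by simp
qed

section \<open>Necessity\<close>

text \<open>
  Unrolling the Hamilton cycle into a periodic sequence lets one walk along it by induction from any
  chosen arc. Two entries at distance two differ because the cycle has length at least three.
\<close>
lemma hamiltonian_arc_sequence:
  assumes "hamiltonian (with_proj (three_arc_graph G))"
  obtains f :: "nat \<Rightarrow> 'a \<times> 'a" where
    "\<And>i. f i \<in> parcs G" "\<And>a m. a \<in> parcs G \<Longrightarrow> \<exists>i\<ge>m. f (Suc i) = a"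
    "\<And>i. f i \<noteq> f (Suc (Suc i))" "\<And>i. (fst (f i), fst (f (Suc i))) \<in> parcs G"
    "\<And>i. fst (f (Suc i)) \<noteq> snd (f i)" "\<And>i. fst (f i) \<noteq> snd (f (Suc i))"
proof -
  obtain L where len: "3 \<le> length L" and dist: "distinct L" and set: "set L = parcs G"
    and adj: "\<And>i. i < length L \<Longrightarrow> (L ! i, L ! (Suc i mod length L)) \<in> parcs (three_arc_graph G)"
    using assms unfolding hamiltonian_iff_cyclic_list by (auto simp: three_arc_graph_def)
  let ?n = "length L"
  have n: "0 < ?n" using len by linarith
  define f where "f i = L ! (i mod ?n)" for i
  have arc: "f i \<in> parcs G" for i using n set nth_mem by (auto simp: f_def)
  have step: "(f i, f (Suc i)) \<in> parcs (three_arc_graph G)" for i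
    using adj[of "i mod ?n"] n by (simp add: f_def mod_Suc_eq)
  have surj: "\<exists>i\<ge>m. f (Suc i) = a" if a: "a \<in> parcs G" for a m
  proof -
    obtain j where j: "j < ?n" "L ! j = a" using a set by (metis in_set_conv_nth)
    \<comment> \<open>One period is added before subtracting 1, as \<open>j\<close> may be 0, and \<open>m\<close> periods to get past \<open>m\<close>.\<close>
    let ?i = "j + ?n - 1 + m * ?n"
    have "Suc ?i = j + (Suc m) * ?n" using n by simp
    then have "f (Suc ?i) = L ! ((j + Suc m * ?n) mod ?n)" unfolding f_def by (rule arg_cong)
    then have "f (Suc ?i) = a" using j by (simp only: mod_mult_self1 mod_less)
    moreover have "m * 1 \<le> m * ?n" by (rule mult_le_mono2) (use n in linarith)
    ultimately show ?thesis by (intro exI[of _ ?i]) (use n in linarith)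
  qed
  have two: "f i \<noteq> f (Suc (Suc i))" for i
  proof
    assume "f i = f (Suc (Suc i))"
    then have "Suc (Suc i) mod ?n = i mod ?n"
      using dist n by (simp add: f_def nth_eq_iff_index_eq)
    then have "?n dvd Suc (Suc i) - i" by (subst (asm) mod_eq_dvd_iff_nat) simp_all
    then have "?n dvd 2" by simp
    then show False using len by (auto dest: dvd_imp_le)
  qed
  have "(fst (f i), fst (f (Suc i))) \<in> parcs G \<and> fst (f (Suc i)) \<noteq> snd (f i) \<and> fst (f i) \<noteq> snd (f (Suc i))" for i
    using step[of i] by (auto simp: three_arc_graph_def three_arc_def)
  then show ?thesis using that arc surj two by blast
qed

text \<open>
  Applied with \<open>l\<close> the label of a visit to \<open>u\<close>, this says that the walk leaves \<open>u\<close> to where it came from.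
\<close>
lemma degree_two_unique:
  assumes "degree G u = 2" "(u, l) \<in> parcs G" "(u, x) \<in> parcs G" "(u, y) \<in> parcs G" "x \<noteq> l" "y \<noteq> l"
  shows "x = y"
proof -
  obtain y1 y2 where "parcs G `` {u} = {y1, y2}"
    using assms(1) unfolding degree_eq_card card_2_iff by auto
  then have "l \<in> {y1, y2}" "x \<in> {y1, y2}" "y \<in> {y1, y2}" using assms(2-4) by blast+
  then show ?thesis using assms(5,6) by auto
qed

theorem three_arc_graph_hamiltonian_necessary:
  assumes ham: "hamiltonian (with_proj (three_arc_graph G))"
    and isolated: "\<forall>v\<in>pverts G. degree G v \<noteq> 0"
  shows "\<forall>v\<in>pverts G. degree G v \<ge> 2"
    and "\<forall>u\<in>pverts G. \<forall>v\<in>pverts G. degree G u = 2 \<and> degree G v = 2 \<longrightarrow> (u, v) \<notin> parcs G"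
    and "connected (with_proj G \<restriction> (pverts G - {v \<in> pverts G. degree G v = 2}))"
proof -
  obtain f :: "nat \<Rightarrow> 'a \<times> 'a" where
    arc: "\<And>i. f i \<in> parcs G" and surj: "\<And>a m. a \<in> parcs G \<Longrightarrow> \<exists>i\<ge>m. f (Suc i) = a"
    and two: "\<And>i. f i \<noteq> f (Suc (Suc i))" and adj: "\<And>i. (fst (f i), fst (f (Suc i))) \<in> parcs G"
    and ne: "\<And>i. fst (f (Suc i)) \<noteq> snd (f i)" "\<And>i. fst (f i) \<noteq> snd (f (Suc i))"
    using hamiltonian_arc_sequence[OF ham] by metis
  have adj': "(fst (f (Suc i)), fst (f i)) \<in> parcs G" for i using adj arcs_symmetric by blast
  have out: "\<exists>w. (v, w) \<in> parcs G" if "v \<in> pverts G" for v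
    using that isolated by (force simp: degree_eq_card)
  show "\<forall>v\<in>pverts G. degree G v \<ge> 2"
  proof
    fix v assume "v \<in> pverts G"
    then obtain w where "(v, w) \<in> parcs G" using out by auto
    then obtain i where i: "f (Suc i) = (v, w)" using surj by blast
    have "card {w, fst (f i)} \<le> card (parcs G `` {v})"
      using adj'[of i] i \<open>(v, w) \<in> parcs G\<close> by (intro card_mono finite_out_neighbours) auto
    then show "degree G v \<ge> 2" using ne(2)[of i] i by (auto simp: degree_eq_card)
  qed
  show indep: "\<forall>u\<in>pverts G. \<forall>v\<in>pverts G. degree G u = 2 \<and> degree G v = 2 \<longrightarrow> (u, v) \<notin> parcs G"
  proof (intro ballI impI notI)
    fix u w assume deg: "degree G u = 2 \<and> degree G w = 2" and uw: "(u, w) \<in> parcs G"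
    \<comment> \<open>Before and after the arc \<open>uc\<close> the walk is at \<open>w\<close>, and neither visit is labelled \<open>u\<close>. Only one label
      is left for both.\<close>
    obtain c where c: "(u, c) \<in> parcs G" "c \<noteq> w"
      using deg uw unfolding degree_eq_card card_2_iff by auto
    obtain i where i: "f (Suc i) = (u, c)" using surj[OF c(1)] by blast
    have "fst (f i) = w"
      using degree_two_unique[of u c "fst (f i)" w] deg c uw adj'[of i] ne(2)[of i] i by auto
    moreover have "fst (f (Suc (Suc i))) = w"
      using degree_two_unique[of u c "fst (f (Suc (Suc i)))" w] deg c uw adj[of "Suc i"] ne(1)[of "Suc i"] i by auto
    ultimately have arcs: "f i = (w, snd (f i))" "f (Suc (Suc i)) = (w, snd (f (Suc (Suc i))))"
      by (simp_all add: prod_eq_iff)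
    have "snd (f i) = snd (f (Suc (Suc i)))"
      using degree_two_unique[of w u "snd (f i)" "snd (f (Suc (Suc i)))"] deg arcs_symmetric[OF uw]
        arc[of i] arc[of "Suc (Suc i)"] arcs ne(1)[of i] ne(2)[of "Suc i"] i by auto
    then show False using two[of i] arcs by simp
  qed
  let ?S = "pverts G - {v \<in> pverts G. degree G v = 2}"
  have "fst (f 0) \<in> ?S \<or> fst (f 1) \<in> ?S"
    using indep adj[of 0] in_arcsD1[OF adj[of 0]] in_arcsD2[OF adj[of 0]] by auto
  then have "?S \<noteq> {}" by blast
  moreover have "W = ?S" if W: "W \<noteq> {}" "W \<subseteq> ?S"
    and closed: "\<And>a b. a \<in> W \<Longrightarrow> b \<in> ?S \<Longrightarrow> (a, b) \<in> parcs G \<Longrightarrow> b \<in> W" for W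
  proof
    let ?t = "\<lambda>i. fst (f i)"
    obtain s where s: "s \<in> W" using W by auto
    then obtain w where "(s, w) \<in> parcs G" using W out by auto
    then obtain m where m: "f (Suc m) = (s, w)" using surj by blast
    \<comment> \<open>The walk cannot leave \<open>W\<close> except into a vertex of degree two, from where it returns at once.\<close>
    have inv: "?t (Suc i) \<in> W \<or> ?t (Suc i) \<notin> ?S \<and> ?t i \<in> W" if "m \<le> i" for i
      using that
    proof (induction i rule: dec_induct)
      case base
      show ?case using s m by simp
    next
      case (step i)
      have V: "?t j \<in> pverts G" for j using adj[of j] by (rule in_arcsD1)
      show ?case
      proof (cases "?t (Suc i) \<in> W")
        case True
        then show ?thesis using closed[OF True _ adj[of "Suc i"]] by blast
      next
        case False
        then have "?t (Suc i) \<notin> ?S" "?t i \<in> W" using step.IH by auto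
        then have deg: "degree G (?t (Suc i)) = 2" using V by simp
        have "?t i = ?t (Suc (Suc i))"
          using degree_two_unique[OF deg _ adj'[of i] adj[of "Suc i"], of "snd (f (Suc i))"]
            arc[of "Suc i"] ne(2)[of i] ne(1)[of "Suc i"] by simp
        then show ?thesis using \<open>?t i \<in> W\<close> by simp
      qed
    qed
    show "?S \<subseteq> W"
    proof
      fix v assume v: "v \<in> ?S"
      then obtain w where "(v, w) \<in> parcs G" using out by auto
      then obtain i where "m \<le> i" "f (Suc i) = (v, w)" using surj by blast
      then show "v \<in> W" using inv[of i] v by simp
    qed
  qed (fact W)
  ultimately show "connected (with_proj G \<restriction> ?S)"
    by (subst connected_induce_iff) (auto simp del: Diff_iff mem_Collect_eq)
qed

end

section \<open>The characterisation\<close>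

theorem theorem1:
  fixes G :: "'a pair_pre_digraph"
  assumes "pair_graph G"
    and "\<forall>v \<in> pverts G. degree G v \<noteq> 0"
  shows "hamiltonian (with_proj (three_arc_graph G)) \<longleftrightarrow>
    min_degree G \<ge> 2 \<and>
    (\<forall>u \<in> pverts G. \<forall>v \<in> pverts G.
       degree G u = 2 \<and> degree G v = 2 \<longrightarrow> (u, v) \<notin> parcs G) \<and>
    connected (with_proj G \<restriction> (pverts G - {v \<in> pverts G. degree G v = 2}))"
proof -
  interpret pair_graph G by (fact assms(1))
  have min: "min_degree G \<ge> 2 \<longleftrightarrow> (\<forall>v\<in>pverts G. degree G v \<ge> 2)" if "pverts G \<noteq> {}"
    using that pair_finite_verts unfolding min_degree_def by (subst Min_ge_iff) auto
  show ?thesis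
  proof
    assume ham: "hamiltonian (with_proj (three_arc_graph G))"
    then have "parcs G \<noteq> {}"
      unfolding hamiltonian_iff_cyclic_list by (auto simp: three_arc_graph_def)
    then obtain u v where "(u, v) \<in> parcs G" by auto
    then have "pverts G \<noteq> {}" using in_arcsD1[of u v] by blast
    then show "min_degree G \<ge> 2 \<and>
      (\<forall>u \<in> pverts G. \<forall>v \<in> pverts G.
         degree G u = 2 \<and> degree G v = 2 \<longrightarrow> (u, v) \<notin> parcs G) \<and>
      connected (with_proj G \<restriction> (pverts G - {v \<in> pverts G. degree G v = 2}))"
      using three_arc_graph_hamiltonian_necessary[OF ham assms(2)] min by blast
  next
    assume R: "min_degree G \<ge> 2 \<and>
      (\<forall>u \<in> pverts G. \<forall>v \<in> pverts G.
         degree G u = 2 \<and> degree G v = 2 \<longrightarrow> (u, v) \<notin> parcs G) \<and>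
      connected (with_proj G \<restriction> (pverts G - {v \<in> pverts G. degree G v = 2}))"
    then have "pverts G \<noteq> {}"
      using connected_induce_iff[of "pverts G - {v \<in> pverts G. degree G v = 2}"] by auto
    then show "hamiltonian (with_proj (three_arc_graph G))"
      using R min three_arc_graph_hamiltonian by blast
  qed
qed

end
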